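(* Let $S$ be a polynomial ring in finitely many variables over a field $K$ and let $I\subset S$ be an ideal minimally generated by three quadratic binomials. Suppose that (i) $I$ is prime, (ii) $S/I$ is Cohen--Macaulay, and (iii) $I$ has linear resolution. Then there is a matrix whose entries are (not necessarily distinct) variables of $S$ such that $I$ is generated by all $2$-minors of this matrix. If, in addition, $I$ is minimally generated by three quadratic squarefree binomials, then there are six pairwise distinct variables $x_1,x_2,x_3,y_1,y_2,y_3$ of $S$ such that $$I=(x_1y_2-x_2y_1,\; x_1y_3-x_3y_1,\; x_2y_3-x_3y_2).$$
   Context: $S$ has the standard grading. A quadratic binomial is a polynomial $u-v$ with $u\neq v$ monomials of degree $2$ in $S$; it is squarefree if both $u$ and $v$ are squarefree monomials. An ideal generated in degree $2$ has linear resolution if its minimal graded free resolution is linear, i.e. its Castelnuovo--Mumford regularity equals $2$. *)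

theory Defs
  imports
    "HOL-Algebra.QuotRing"
    "HOL-Algebra.Ring_Divisibility"
    "HOL-Library.Poly_Mapping"
    "HOL-Library.Extended_Nat"
begin

section \<open>Polynomial rings\<close>

text \<open>Monomials are exponent vectors; a polynomial is a finitely supported map from monomials
  to coefficients, so that ring operations come from the library instances of \<open>poly_mapping\<close>.\<close>

type_synonym 'x monomial = "'x \<Rightarrow>\<^sub>0 nat"
type_synonym ('x, 'k) mpoly = "('x \<Rightarrow>\<^sub>0 nat) \<Rightarrow>\<^sub>0 'k"

definition poly_ring :: "('x, 'k::field) mpoly ring" where
  "poly_ring = \<lparr>carrier = UNIV, mult = (*), one = 1, zero = 0, add = (+)\<rparr>"

definition Monom :: "'x monomial \<Rightarrow> ('x, 'k::field) mpoly" where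
  "Monom m = Poly_Mapping.single m 1"

definition Var :: "'x \<Rightarrow> ('x, 'k::field) mpoly" where
  "Var x = Monom (Poly_Mapping.single x 1)"

definition mdeg :: "'x monomial \<Rightarrow> nat" where
  "mdeg m = (\<Sum>x\<in>Poly_Mapping.keys m. Poly_Mapping.lookup m x)"

definition squarefree_monomial :: "'x monomial \<Rightarrow> bool" where
  "squarefree_monomial m \<longleftrightarrow> (\<forall>x. Poly_Mapping.lookup m x \<le> 1)"

definition quadratic_binomial :: "('x, 'k::field) mpoly \<Rightarrow> bool" where
  "quadratic_binomial f \<longleftrightarrow>
     (\<exists>u v. mdeg u = 2 \<and> mdeg v = 2 \<and> u \<noteq> v \<and> f = Monom u - Monom v)"

definition squarefree_quadratic_binomial :: "('x, 'k::field) mpoly \<Rightarrow> bool" where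
  "squarefree_quadratic_binomial f \<longleftrightarrow>
     (\<exists>u v. mdeg u = 2 \<and> mdeg v = 2 \<and> u \<noteq> v \<and> f = Monom u - Monom v \<and>
        squarefree_monomial u \<and> squarefree_monomial v)"

definition minimally_generates :: "('a, 'b) ring_scheme \<Rightarrow> 'a set \<Rightarrow> 'a set \<Rightarrow> bool" where
  "minimally_generates R F I \<longleftrightarrow>
     F \<subseteq> carrier R \<and> I = Idl\<^bsub>R\<^esub> F \<and> (\<forall>G. G \<subset> F \<longrightarrow> Idl\<^bsub>R\<^esub> G \<noteq> I)"

definition two_minors :: "nat \<Rightarrow> nat \<Rightarrow> (nat \<Rightarrow> nat \<Rightarrow> 'a::comm_ring) \<Rightarrow> 'a set" where
  "two_minors r c A =
     {A i j * A k l - A i l * A k j | i j k l. i < k \<and> k < r \<and> j < l \<and> l < c}"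

section \<open>Cohen--Macaulay rings\<close>

text \<open>The last condition says that each entry of the sequence is a nonzerodivisor modulo the
  ideal generated by the preceding ones.\<close>

definition regular_sequence :: "('a, 'b) ring_scheme \<Rightarrow> 'a list \<Rightarrow> bool" where
  "regular_sequence R xs \<longleftrightarrow>
     set xs \<subseteq> carrier R \<and> Idl\<^bsub>R\<^esub> (set xs) \<noteq> carrier R \<and>
     (\<forall>i<length xs. \<forall>a\<in>carrier R.
        xs ! i \<otimes>\<^bsub>R\<^esub> a \<in> Idl\<^bsub>R\<^esub> (set (take i xs)) \<longrightarrow> a \<in> Idl\<^bsub>R\<^esub> (set (take i xs)))"

definition ideal_depth :: "('a, 'b) ring_scheme \<Rightarrow> 'a set \<Rightarrow> enat" where
  "ideal_depth R J = (SUP xs \<in> {xs. regular_sequence R xs \<and> set xs \<subseteq> J}. enat (length xs))"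

text \<open>The primes listed are those strictly below \<open>P\<close>, so a chain
  \<open>P\<^sub>0 \<subset> \<dots> \<subset> P\<^sub>n = P\<close> contributes \<open>n\<close>.\<close>

definition prime_height :: "('a, 'b) ring_scheme \<Rightarrow> 'a set \<Rightarrow> enat" where
  "prime_height R P =
     (SUP Qs \<in> {Qs. sorted_wrt (\<subset>) Qs \<and> (\<forall>Q\<in>set Qs. primeideal Q R \<and> Q \<subset> P)}.
        enat (length Qs))"

text \<open>Eisenbud's definition (Commutative Algebra, Section 18.2). Both sides agree with the depth
  and the dimension of the local ring at \<open>P\<close>, so no localization is needed.\<close>

definition cohen_macaulay :: "('a, 'b) ring_scheme \<Rightarrow> bool" where
  "cohen_macaulay R \<longleftrightarrow>
     cring R \<and> noetherian_ring R \<and>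
     (\<forall>P. maximalideal P R \<longrightarrow> ideal_depth R P = prime_height R P)"

section \<open>Graded free resolutions\<close>

text \<open>A complex of graded free modules
  \<open>\<dots> \<rightarrow> F\<^sub>2 \<rightarrow> F\<^sub>1 \<rightarrow> F\<^sub>0 \<rightarrow> I \<rightarrow> 0\<close>
  is given by the ranks \<open>b i\<close>, the degrees \<open>d i j\<close> of the basis elements of
  \<open>F\<^sub>i = \<Oplus>\<^sub>j S(- d i j)\<close>, the images \<open>g j\<close> in \<open>I\<close> of the basis elements of \<open>F\<^sub>0\<close>, and matrices
  \<open>M i\<close> of the maps from \<open>F\<^sub>i\<^sub>+\<^sub>1\<close> to \<open>F\<^sub>i\<close>. Elements of \<open>F\<^sub>i\<close> are functions of which only the values
  at arguments below \<open>b i\<close> matter. The first two conditions state that the maps are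
  homogeneous of degree zero, the remaining ones that the complex is exact.\<close>

definition graded_free_resolution ::
  "('x, 'k::field) mpoly set \<Rightarrow> (nat \<Rightarrow> nat) \<Rightarrow> (nat \<Rightarrow> nat \<Rightarrow> int) \<Rightarrow>
     (nat \<Rightarrow> ('x, 'k) mpoly) \<Rightarrow> (nat \<Rightarrow> nat \<Rightarrow> nat \<Rightarrow> ('x, 'k) mpoly) \<Rightarrow> bool" where
  "graded_free_resolution I b d g M \<longleftrightarrow>
     (\<forall>j<b 0. \<forall>m\<in>Poly_Mapping.keys (g j). int (mdeg m) = d 0 j) \<and>
     (\<forall>i. \<forall>j<b i. \<forall>k<b (Suc i). \<forall>m\<in>Poly_Mapping.keys (M i j k).
        d i j + int (mdeg m) = d (Suc i) k) \<and>
     I = {(\<Sum>j<b 0. g j * v j) | v. True} \<and>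
     (\<forall>v. (\<Sum>j<b 0. g j * v j) = 0 \<longleftrightarrow>
        (\<exists>w. \<forall>j<b 0. v j = (\<Sum>k<b 1. M 0 j k * w k))) \<and>
     (\<forall>i v. (\<forall>j<b i. (\<Sum>k<b (Suc i). M i j k * v k) = 0) \<longleftrightarrow>
        (\<exists>w. \<forall>k<b (Suc i). v k = (\<Sum>l<b (Suc (Suc i)). M (Suc i) k l * w l)))"

text \<open>Minimality: the image of \<open>F\<^sub>i\<^sub>+\<^sub>1\<close> lies in the maximal graded ideal times \<open>F\<^sub>i\<close>, that is,
  the matrix entries have zero constant term.\<close>

definition minimal_graded_free_resolution ::
  "('x, 'k::field) mpoly set \<Rightarrow> (nat \<Rightarrow> nat) \<Rightarrow> (nat \<Rightarrow> nat \<Rightarrow> int) \<Rightarrow>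
     (nat \<Rightarrow> ('x, 'k) mpoly) \<Rightarrow> (nat \<Rightarrow> nat \<Rightarrow> nat \<Rightarrow> ('x, 'k) mpoly) \<Rightarrow> bool" where
  "minimal_graded_free_resolution I b d g M \<longleftrightarrow>
     graded_free_resolution I b d g M \<and>
     (\<forall>i. \<forall>j<b i. \<forall>k<b (Suc i). Poly_Mapping.lookup (M i j k) 0 = 0)"

text \<open>Since the minimal graded free resolution is unique up to isomorphism, it does not matter
  which one is inspected. The parameter \<open>q\<close> is the degree of the generators.\<close>

definition has_linear_resolution :: "nat \<Rightarrow> ('x, 'k::field) mpoly set \<Rightarrow> bool" where
  "has_linear_resolution q I \<longleftrightarrow>
     (\<exists>b d g M. minimal_graded_free_resolution I b d g M \<and>
        (\<forall>i. \<forall>j<b i. d i j = int (q + i)))"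

lemma cring_poly_ring: "cring (poly_ring :: ('x, 'k::field) mpoly ring)"
proof (rule cringI)
  show "abelian_group (poly_ring :: ('x, 'k) mpoly ring)"
  proof (rule abelian_groupI)
    fix x :: "('x, 'k) mpoly"
    assume "x \<in> carrier poly_ring"
    have "- x + x = 0" by simp
    then show "\<exists>y\<in>carrier poly_ring. y \<oplus>\<^bsub>poly_ring\<^esub> x = \<zero>\<^bsub>poly_ring\<^esub>"
      by (intro bexI[of _ "- x"]) (simp_all add: poly_ring_def)
  qed (simp_all add: poly_ring_def algebra_simps)
  show "comm_monoid (poly_ring :: ('x, 'k) mpoly ring)"
    by (rule comm_monoidI) (simp_all add: poly_ring_def algebra_simps)
qed (simp add: poly_ring_def algebra_simps)

end

theory Submission
  imports Defs
begin

text \<open>Call two quadratic monomials congruent if their difference lies in the prime ideal \<open>I\<close>. As \<open>I\<close>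
  contains no linear form, distinct congruent monomials are coprime. A linear resolution yields, by
  comparison with the Koszul syzygies, a family \<open>h\<^sub>x\<close> in the span of the three
  binomials with \<open>\<Sum>x h\<^sub>x = 0\<close>, not all zero. Each monomial of \<open>h\<^sub>x\<close> is congruent to another one, and each
  product \<open>x m\<close> with \<open>m\<close> in \<open>h\<^sub>x\<close> equals some \<open>y n\<close> with \<open>y \<noteq> x\<close> and \<open>n\<close> in \<open>h\<^sub>y\<close>. Alternating between
  these two moves, coprimality forces the closed walk
  \<open>x\<cdot>zr \<sim> x\<cdot>yp = y\<cdot>xp \<sim> y\<cdot>zq = z\<cdot>yq \<sim> z\<cdot>xr = x\<cdot>zr\<close>, so the generators are
  \<open>zr - yp\<close>, \<open>xp - zq\<close> and \<open>yq - xr\<close> up to sign: the 2-minors of the matrix with rows \<open>(x, y, z)\<close>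
  and \<open>(q, r, p)\<close>.\<close>

section \<open>Ideals of the polynomial ring\<close>

lemma ring_poly_ring: "ring (poly_ring :: ('x, 'k::field) mpoly ring)"
  using cring_poly_ring by (rule cring.axioms)

text \<open>Multiplication by -1 supplies negatives and commutativity the other side, so these
  closure conditions suffice.\<close>

lemma ideal_poly_ring_iff:
  fixes J :: "('x, 'k::field) mpoly set"
  shows "ideal J poly_ring \<longleftrightarrow>
    0 \<in> J \<and> (\<forall>a\<in>J. \<forall>b\<in>J. a + b \<in> J) \<and> (\<forall>a\<in>J. \<forall>p. p * a \<in> J)" (is "_ = ?rhs")
proof
  assume "ideal J poly_ring"
  then interpret ideal J poly_ring .
  show ?rhs
    using additive_subgroup.zero_closed[OF is_additive_subgroup]
      additive_subgroup.a_closed[OF is_additive_subgroup] I_l_closed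
    by (simp add: poly_ring_def)
next
  assume R: ?rhs
  interpret R: ring "poly_ring :: ('x, 'k) mpoly ring" by (rule ring_poly_ring)
  have uminus: "\<ominus>\<^bsub>poly_ring\<^esub> a = - a" for a :: "('x, 'k) mpoly"
    by (rule R.minus_equality) (simp_all add: poly_ring_def)
  show "ideal J poly_ring"
  proof (rule idealI[OF ring_poly_ring])
    show "subgroup J (add_monoid poly_ring)"
    proof (rule group.subgroupI[OF R.a_group])
      fix a assume "a \<in> J"
      with R have "- 1 * a \<in> J" by blast
      then show "inv\<^bsub>add_monoid poly_ring\<^esub> a \<in> J"
        using uminus[of a] by (simp add: a_inv_def)
    qed (use R in \<open>auto simp: poly_ring_def\<close>)
    fix a x assume "a \<in> J"
    with R have "x * a \<in> J" by blast
    then show "x \<otimes>\<^bsub>poly_ring\<^esub> a \<in> J" "a \<otimes>\<^bsub>poly_ring\<^esub> x \<in> J"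
      by (simp_all add: poly_ring_def mult.commute)
  qed
qed

context
  fixes J :: "('x, 'k::field) mpoly set"
  assumes J: "ideal J poly_ring"
begin

lemma ideal_zero: "0 \<in> J"
  and ideal_add: "a \<in> J \<Longrightarrow> b \<in> J \<Longrightarrow> a + b \<in> J"
  and ideal_mult: "a \<in> J \<Longrightarrow> p * a \<in> J"
  using J by (auto simp: ideal_poly_ring_iff)

lemma ideal_uminus: "a \<in> J \<Longrightarrow> - a \<in> J"
  using ideal_mult[of a "-1"] by simp

lemma ideal_sum: "(\<And>i. i \<in> A \<Longrightarrow> f i \<in> J) \<Longrightarrow> sum f A \<in> J"
  by (induction A rule: infinite_finite_induct) (auto intro: ideal_zero ideal_add)

end

lemma ideal_Idl: "ideal (Idl\<^bsub>poly_ring\<^esub> F) (poly_ring :: ('x, 'k::field) mpoly ring)"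
  by (rule ring.genideal_ideal[OF ring_poly_ring]) (simp add: poly_ring_def)

lemma subset_Idl: "F \<subseteq> Idl\<^bsub>poly_ring\<^esub> (F :: ('x, 'k::field) mpoly set)"
  by (rule ring.genideal_self[OF ring_poly_ring]) (simp add: poly_ring_def)

lemma Idl_eqI:
  fixes F G :: "('x, 'k::field) mpoly set"
  assumes "F \<subseteq> Idl\<^bsub>poly_ring\<^esub> G" "G \<subseteq> Idl\<^bsub>poly_ring\<^esub> F"
  shows "Idl\<^bsub>poly_ring\<^esub> F = Idl\<^bsub>poly_ring\<^esub> G"
  using assms by (intro equalityI ring.genideal_minimal[OF ring_poly_ring] ideal_Idl)

text \<open>Membership becomes an explicit combination, whose coefficients can then be compared
  degree by degree.\<close>

lemma Idl_finite:
  fixes F :: "('x, 'k::field) mpoly set"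
  assumes "finite F"
  shows "Idl\<^bsub>poly_ring\<^esub> F = {(\<Sum>f\<in>F. p f * f) | p. True}" (is "_ = ?J")
proof
  have "\<exists>r. (\<Sum>f\<in>F. p f * f) + (\<Sum>f\<in>F. q f * f) = (\<Sum>f\<in>F. r f * f)" for p q
    by (intro exI[of _ "\<lambda>f. p f + q f"]) (simp add: distrib_right sum.distrib)
  moreover have "\<exists>r. a * (\<Sum>f\<in>F. p f * f) = (\<Sum>f\<in>F. r f * f)" for p a
    by (intro exI[of _ "\<lambda>f. a * p f"]) (simp add: sum_distrib_left mult.assoc)
  moreover have "\<exists>p. 0 = (\<Sum>f\<in>F. p f * f)"
    by (intro exI[of _ "\<lambda>f. 0"]) simp
  ultimately have "ideal ?J poly_ring"
    unfolding ideal_poly_ring_iff by blast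
  moreover have "F \<subseteq> ?J"
  proof
    fix g assume "g \<in> F"
    then have "g = (\<Sum>f\<in>F. (if f = g then 1 else 0) * f)"
      using assms by (simp add: if_distrib[where f = "\<lambda>c. c * _"] cong: if_cong)
    then show "g \<in> ?J" by (intro CollectI exI[of _ "\<lambda>f. if f = g then 1 else 0"]) simp
  qed
  ultimately show "Idl\<^bsub>poly_ring\<^esub> F \<subseteq> ?J"
    by (rule ring.genideal_minimal[OF ring_poly_ring])
  show "?J \<subseteq> Idl\<^bsub>poly_ring\<^esub> F"
    using subset_Idl by (auto intro!: ideal_sum[OF ideal_Idl] ideal_mult[OF ideal_Idl])
qed

section \<open>Degrees and coefficients\<close>

lemma mdeg_finite: "mdeg (m :: 'x::finite monomial) = (\<Sum>x\<in>UNIV. Poly_Mapping.lookup m x)"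
  unfolding mdeg_def by (rule sum.mono_neutral_left) (auto simp: in_keys_iff)

lemma mdeg_add: "mdeg (m + n) = mdeg m + mdeg (n :: 'x::finite monomial)"
  by (simp add: mdeg_finite lookup_add sum.distrib)

lemma mdeg_single [simp]: "mdeg (Poly_Mapping.single x k) = k"
  by (simp add: mdeg_def)

lemma mdeg_eq_0_iff [simp]: "mdeg (m :: 'x::finite monomial) = 0 \<longleftrightarrow> m = 0"
  by (auto simp: mdeg_finite intro: poly_mapping_eqI)

abbreviation sng :: "'x \<Rightarrow> 'x monomial" where
  "sng x \<equiv> Poly_Mapping.single x 1"

lemma monomial_split:
  assumes "Poly_Mapping.lookup m x > 0"
  obtains n where "m = sng x + n"
proof
  show "m = sng x + (m - sng x)"
    using assms by (intro poly_mapping_eqI) (auto simp: lookup_add lookup_minus lookup_single when_def)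
qed

lemma mdeg_pos_obtains:
  assumes "mdeg (m :: 'x::finite monomial) > 0"
  obtains x n where "m = sng x + n"
proof -
  from assms obtain x where "Poly_Mapping.lookup m x > 0"
    by (metis mdeg_finite neq0_conv sum.neutral)
  then obtain n where "m = sng x + n" by (rule monomial_split)
  then show ?thesis by (rule that)
qed

lemma mdeg_1_obtains:
  assumes "mdeg (m :: 'x::finite monomial) = 1"
  obtains x where "m = sng x"
proof -
  from assms have "mdeg m > 0" by simp
  then obtain x n where "m = sng x + n" by (rule mdeg_pos_obtains)
  with assms show ?thesis
    using that by (auto simp: mdeg_add)
qed

text \<open>Since \<open>y\<close> divides \<open>x m\<close> and differs from \<open>x\<close>, it
  divides \<open>m\<close>; the cofactor has degree 1 and is the variable \<open>p\<close>. This is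
  the swap \<open>x(yp) = y(xp)\<close> used by the walks.\<close>

lemma exchange:
  assumes "sng x + m = sng y + n" "x \<noteq> y" "mdeg (m :: 'x::finite monomial) = 2"
  obtains p where "m = sng y + sng p" "n = sng x + sng p"
proof -
  have "Poly_Mapping.lookup (sng x + m) y > 0"
    unfolding assms(1) by (simp add: lookup_add)
  then have "Poly_Mapping.lookup m y > 0"
    using assms(2) by (simp add: lookup_add lookup_single_not_eq)
  then obtain k where k: "m = sng y + k" by (rule monomial_split)
  with assms(3) have "mdeg k = 1" by (simp add: mdeg_add)
  then obtain p where p: "k = sng p" by (rule mdeg_1_obtains)
  have "sng y + (sng x + k) = sng y + n"
    using assms(1) k by (simp only: add.left_commute)
  then have "n = sng x + k" by (simp only: add_left_cancel)
  with k p show ?thesis using that by simp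
qed

lemma lookup_Monom_mult:
  "Poly_Mapping.lookup (Monom a * h) (a + m) = Poly_Mapping.lookup (h :: ('x, 'k::field) mpoly) m"
  by (simp add: Monom_def lookup_mult lookup_single when_mult)

lemma keys_Monom_mult:
  assumes "Poly_Mapping.lookup (Monom a * (h :: ('x, 'k::field) mpoly)) w \<noteq> 0"
  obtains m where "w = a + m" "Poly_Mapping.lookup h m \<noteq> 0"
proof -
  have "w \<in> Poly_Mapping.keys (Monom a * h)" using assms by (simp add: in_keys_iff)
  then obtain c b where "w = c + b" "c \<in> Poly_Mapping.keys (Monom a :: ('x, 'k) mpoly)"
      "b \<in> Poly_Mapping.keys h"
    using keys_mult[of "Monom a" h] by blast
  then show ?thesis using that by (auto simp: Monom_def in_keys_iff)
qed

lemma lookup_const_mult [simp]: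
  "Poly_Mapping.lookup (Poly_Mapping.single 0 c * p) m = c * Poly_Mapping.lookup (p :: ('x, 'k::field) mpoly) m"
  unfolding mult_map_scale_conv_mult[symmetric] by (simp add: Poly_Mapping.map.rep_eq when_def)

text \<open>The zero polynomial counts as homogeneous of every degree.\<close>

definition homogeneous :: "nat \<Rightarrow> ('x, 'k::field) mpoly \<Rightarrow> bool" where
  "homogeneous d p \<longleftrightarrow> (\<forall>m. Poly_Mapping.lookup p m \<noteq> 0 \<longrightarrow> mdeg m = d)"

text \<open>All monomials of \<open>q\<close> already have degree \<open>d\<close>, so only the
  constant term of \<open>p\<close> contributes in that degree.\<close>

lemma lookup_mult_homogeneous:
  fixes p q :: "('x::finite, 'k::field) mpoly"
  assumes "homogeneous d q" "mdeg m = d"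
  shows "Poly_Mapping.lookup (p * q) m = Poly_Mapping.lookup p 0 * Poly_Mapping.lookup q m"
proof -
  define p' where "p' = p - Poly_Mapping.single 0 (Poly_Mapping.lookup p 0)"
  have "m \<notin> Poly_Mapping.keys (p' * q)"
  proof
    assume "m \<in> Poly_Mapping.keys (p' * q)"
    then obtain a b where ab: "m = a + b" "a \<in> Poly_Mapping.keys p'" "b \<in> Poly_Mapping.keys q"
      using keys_mult[of p' q] by blast
    then have "mdeg a = 0" using assms by (auto simp: homogeneous_def mdeg_add in_keys_iff simp del: mdeg_eq_0_iff)
    with ab(2) show False by (simp add: p'_def in_keys_iff lookup_minus)
  qed
  moreover have "p * q = p' * q + Poly_Mapping.single 0 (Poly_Mapping.lookup p 0) * q"
    by (simp add: p'_def algebra_simps)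
  ultimately show ?thesis by (simp add: lookup_add in_keys_iff)
qed

text \<open>Reduces membership in an ideal to membership in the linear span of its generators when
  all degrees agree.\<close>

lemma homogeneous_sum_constant_coeffs:
  fixes q :: "'i \<Rightarrow> ('x::finite, 'k::field) mpoly"
  assumes "homogeneous d h" "h = (\<Sum>i\<in>A. p i * q i)" "\<And>i. i \<in> A \<Longrightarrow> homogeneous d (q i)"
  shows "h = (\<Sum>i\<in>A. Poly_Mapping.single 0 (Poly_Mapping.lookup (p i) 0) * q i)"
proof (rule poly_mapping_eqI)
  fix m
  show "Poly_Mapping.lookup h m =
    Poly_Mapping.lookup (\<Sum>i\<in>A. Poly_Mapping.single 0 (Poly_Mapping.lookup (p i) 0) * q i) m"
  proof (cases "mdeg m = d")
    case True
    then show ?thesis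
      using assms(3) unfolding assms(2) lookup_sum lookup_const_mult
      by (intro sum.cong refl lookup_mult_homogeneous)
  next
    case False
    then have "Poly_Mapping.lookup h m = 0" "\<And>i. i \<in> A \<Longrightarrow> Poly_Mapping.lookup (q i) m = 0"
      using assms(1,3) by (auto simp: homogeneous_def)
    then show ?thesis by (simp add: lookup_sum)
  qed
qed

lemma homogeneous_1_expansion:
  fixes p :: "('x::finite, 'k::field) mpoly"
  assumes "homogeneous 1 p"
  shows "p = (\<Sum>x\<in>UNIV. Poly_Mapping.single 0 (Poly_Mapping.lookup p (sng x)) * Var x)"
proof (rule poly_mapping_eqI)
  fix m
  show "Poly_Mapping.lookup p m =
    Poly_Mapping.lookup (\<Sum>x\<in>UNIV. Poly_Mapping.single 0 (Poly_Mapping.lookup p (sng x)) * Var x) m"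
  proof (cases "mdeg m = 1")
    case True
    then obtain y where "m = sng y" by (rule mdeg_1_obtains)
    moreover have "(sng x = sng y) = (x = y)" for x y :: 'x
      by (metis keys_single singleton_inject zero_neq_one)
    ultimately show ?thesis
      by (simp add: lookup_sum Var_def Monom_def lookup_single when_def if_distrib cong: if_cong)
  next
    case False
    then have "sng x \<noteq> m" for x by auto
    moreover have "Poly_Mapping.lookup p m = 0" using False assms by (auto simp: homogeneous_def)
    ultimately show ?thesis
      by (simp add: lookup_sum Var_def Monom_def lookup_single)
  qed
qed

section \<open>A linear syzygy\<close>

abbreviation const :: "'k::field \<Rightarrow> ('x, 'k) mpoly" where
  "const \<equiv> Poly_Mapping.single 0"

lemma const_sum: "const (sum c A) = (\<Sum>i\<in>A. const (c i))"
  by (induction A rule: infinite_finite_induct) (simp_all add: single_add)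

lemma const_mult: "const (a * b) = const a * const b"
  by (simp add: mult_single)

text \<open>Dividing a relation by some \<open>c f \<noteq> 0\<close> would put \<open>f\<close>
  into the ideal of the other generators, against minimality.\<close>

lemma minimal_generators_independent:
  fixes F I :: "('x, 'k::field) mpoly set"
  assumes "finite F" "minimally_generates poly_ring F I"
    and eq: "(\<Sum>f\<in>F. const (c f) * f) = 0" and "f \<in> F"
  shows "c f = 0"
proof (rule ccontr)
  assume nz: "c f \<noteq> 0"
  let ?J = "Idl\<^bsub>poly_ring\<^esub> (F - {f})"
  have "const (c f) * f = - (\<Sum>g\<in>F - {f}. const (c g) * g)"
    using eq \<open>finite F\<close> \<open>f \<in> F\<close> by (simp add: sum.remove eq_neg_iff_add_eq_0)
  also have "\<dots> \<in> ?J"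
    using subset_Idl[of "F - {f}"]
    by (intro ideal_uminus[OF ideal_Idl] ideal_sum[OF ideal_Idl] ideal_mult[OF ideal_Idl]) auto
  finally have "const (inverse (c f)) * (const (c f) * f) \<in> ?J"
    by (rule ideal_mult[OF ideal_Idl])
  then have "f \<in> ?J"
    using nz by (simp add: mult.assoc[symmetric] mult_single)
  then have "?J = Idl\<^bsub>poly_ring\<^esub> F"
    using subset_Idl[of "F - {f}"] subset_Idl[of F] by (intro Idl_eqI) auto
  then show False
    using assms(2) \<open>f \<in> F\<close> unfolding minimally_generates_def by blast
qed

text \<open>The linear resolution makes all syzygies of the generators \<open>g j\<close> combinations of linear ones.
  Rewritten in terms of \<open>F\<close>, some linear syzygy has to be nonzero, since otherwise the Koszul syzygy
  of \<open>f1, f2 \<in> F\<close> would vanish.\<close>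

lemma linear_syzygy_obtains:
  fixes F I :: "('x::finite, 'k::field) mpoly set"
  assumes res: "has_linear_resolution q I"
    and fin: "finite F" and card: "card F \<ge> 2"
    and min: "minimally_generates poly_ring F I"
    and hom: "\<And>f. f \<in> F \<Longrightarrow> homogeneous q f"
  obtains c x where "(\<Sum>x\<in>UNIV. Var x * (\<Sum>f\<in>F. const (c x f) * f)) = 0"
    and "(\<Sum>f\<in>F. const (c x f) * f) \<noteq> 0"
proof -
  note indep = minimal_generators_independent[OF fin min]
  have I: "I = Idl\<^bsub>poly_ring\<^esub> F" using min by (simp add: minimally_generates_def)
  obtain b d g M where M: "graded_free_resolution I b d g M" and d: "\<And>i j. j < b i \<Longrightarrow> d i j = int (q + i)"
    using res by (auto simp: has_linear_resolution_def minimal_graded_free_resolution_def)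
  have Ig: "I = {(\<Sum>j<b 0. g j * v j) | v. True}"
    and exact: "\<And>v. (\<Sum>j<b 0. g j * v j) = 0 \<longleftrightarrow> (\<exists>w. \<forall>j<b 0. v j = (\<Sum>k<b 1. M 0 j k * w k))"
    using M by (auto simp: graded_free_resolution_def)
  have g_hom: "homogeneous q (g j)" if "j < b 0" for j
    using M d[OF that] that
    by (fastforce simp: graded_free_resolution_def homogeneous_def in_keys_iff)
  \<comment> \<open>The basis degrees are \<open>q\<close> in step 0 and \<open>q + 1\<close> in
    step 1, so the entries of \<open>M 0\<close> are linear forms.\<close>
  have M_hom: "homogeneous 1 (M 0 j k)" if "j < b 0" "k < b 1" for j k
  proof -
    have "d 0 j + int (mdeg m) = d (Suc 0) k" if "Poly_Mapping.lookup (M 0 j k) m \<noteq> 0" for m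
      using M that \<open>j < b 0\<close> \<open>k < b 1\<close> unfolding graded_free_resolution_def
      by (simp add: in_keys_iff)
    then show ?thesis using d[of j 0] d[of k 1] that by (auto simp: homogeneous_def)
  qed
  \<comment> \<open>Both \<open>F\<close> and the \<open>g j\<close> generate \<open>I\<close> in
    degree \<open>q\<close>, so each family is a combination of the other with constant
    coefficients: \<open>\<gamma>\<close> here, \<open>\<alpha>\<close> below.\<close>
  have "\<forall>j. \<exists>\<gamma>. j < b 0 \<longrightarrow> g j = (\<Sum>f\<in>F. const (\<gamma> f) * f)"
  proof (intro allI)
    fix j
    show "\<exists>\<gamma>. j < b 0 \<longrightarrow> g j = (\<Sum>f\<in>F. const (\<gamma> f) * f)"
    proof (cases "j < b 0")
      case True
      then have "g j \<in> I"
        unfolding Ig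
        by (intro CollectI exI[of _ "\<lambda>i. if i = j then 1 else 0"]) (simp add: if_distrib cong: if_cong)
      then obtain p where "g j = (\<Sum>f\<in>F. p f * f)"
        unfolding I Idl_finite[OF fin] by auto
      with g_hom[OF True] have "g j = (\<Sum>f\<in>F. const (Poly_Mapping.lookup (p f) 0) * f)"
        using hom by (rule homogeneous_sum_constant_coeffs)
      then show ?thesis by (intro exI impI)
    qed simp
  qed
  from choice[OF this] obtain \<gamma> where \<gamma>: "\<And>j. j < b 0 \<Longrightarrow> g j = (\<Sum>f\<in>F. const (\<gamma> j f) * f)"
    by auto
  have "\<forall>f. \<exists>\<alpha>. f \<in> F \<longrightarrow> f = (\<Sum>j<b 0. const (\<alpha> j) * g j)"
  proof (intro allI)
    fix f
    show "\<exists>\<alpha>. f \<in> F \<longrightarrow> f = (\<Sum>j<b 0. const (\<alpha> j) * g j)"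
    proof (cases "f \<in> F")
      case True
      then have "f \<in> I" using subset_Idl[of F] by (auto simp: I)
      then obtain v where "f = (\<Sum>j<b 0. v j * g j)"
        unfolding Ig by (auto simp: mult.commute)
      with hom[OF True] have "f = (\<Sum>j<b 0. const (Poly_Mapping.lookup (v j) 0) * g j)"
        using g_hom by (rule homogeneous_sum_constant_coeffs) simp
      then show ?thesis by (intro exI impI)
    qed simp
  qed
  from choice[OF this] obtain \<alpha> where \<alpha>: "\<And>f. f \<in> F \<Longrightarrow> f = (\<Sum>j<b 0. const (\<alpha> f j) * g j)"
    by auto
  have swap: "(\<Sum>f\<in>F. const (\<Sum>j<b 0. a j * \<gamma> j f) * f) = (\<Sum>j<b 0. const (a j) * g j)" for a
  proof -
    have "(\<Sum>f\<in>F. const (\<Sum>j<b 0. a j * \<gamma> j f) * f) = (\<Sum>f\<in>F. \<Sum>j<b 0. const (a j) * (const (\<gamma> j f) * f))"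
      by (simp add: const_sum const_mult sum_distrib_right mult.assoc)
    also have "\<dots> = (\<Sum>j<b 0. \<Sum>f\<in>F. const (a j) * (const (\<gamma> j f) * f))"
      by (rule sum.swap)
    also have "\<dots> = (\<Sum>j<b 0. const (a j) * g j)"
      using \<gamma> by (simp add: sum_distrib_left)
    finally show ?thesis .
  qed
  \<comment> \<open>Going from \<open>F\<close> to the \<open>g j\<close> and back is the identity,
    because \<open>F\<close> is linearly independent.\<close>
  have \<delta>: "(\<Sum>j<b 0. \<alpha> f j * \<gamma> j f') = (if f' = f then 1 else 0)" if "f \<in> F" "f' \<in> F" for f f'
  proof -
    have "(\<Sum>f'\<in>F. const ((\<Sum>j<b 0. \<alpha> f j * \<gamma> j f') - (if f' = f then 1 else 0)) * f')
      = (\<Sum>f'\<in>F. const (\<Sum>j<b 0. \<alpha> f j * \<gamma> j f') * f') - (\<Sum>f'\<in>F. if f' = f then f' else 0)"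
      unfolding sum_subtractf[symmetric]
      by (rule sum.cong) (simp_all add: single_diff left_diff_distrib)
    also have "\<dots> = 0"
      using \<alpha>[OF that(1)] that fin by (simp add: swap)
    finally show ?thesis
      using indep[of "\<lambda>f'. (\<Sum>j<b 0. \<alpha> f j * \<gamma> j f') - (if f' = f then 1 else 0)" f'] that by simp
  qed
  obtain f1 f2 where F: "f1 \<in> F" "f2 \<in> F" "f1 \<noteq> f2"
    using card fin by (metis One_nat_def card_le_Suc0_iff_eq not_less_eq_eq numeral_2_eq_2)
  have "f1 \<noteq> 0"
  proof
    assume "f1 = 0"
    then have "(\<Sum>f\<in>F. const (if f = f1 then 1 else 0) * f) = 0"
      by (intro sum.neutral) auto
    from indep[OF this F(1)] show False by simp
  qed
  \<comment> \<open>The Koszul syzygy \<open>f2 * f1 - f1 * f2 = 0\<close>, written in terms of the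
    \<open>g j\<close>.\<close>
  define v where "v j = const (\<alpha> f2 j) * f1 - const (\<alpha> f1 j) * f2" for j
  have "(\<Sum>j<b 0. g j * v j) = (\<Sum>j<b 0. const (\<alpha> f2 j) * g j) * f1 - (\<Sum>j<b 0. const (\<alpha> f1 j) * g j) * f2"
    unfolding sum_distrib_right sum_subtractf[symmetric]
    by (rule sum.cong) (simp_all add: v_def algebra_simps)
  also have "\<dots> = 0"
    using \<alpha>[OF F(1)] \<alpha>[OF F(2)] by simp
  finally obtain w where w: "\<And>j. j < b 0 \<Longrightarrow> v j = (\<Sum>k<b 1. M 0 j k * w k)"
    using exact by blast
  \<comment> \<open>The coordinate at \<open>f2\<close> of the \<open>k\<close>-th column of
    \<open>M 0\<close>. The same coordinate of \<open>v\<close> is \<open>f1 \<noteq> 0\<close>, and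
    it is a combination of the \<open>L k\<close>, so some \<open>L k\<close> is nonzero.\<close>
  define L where "L k = (\<Sum>j<b 0. const (\<gamma> j f2) * M 0 j k)" for k
  have "(\<Sum>k<b 1. L k * w k) = (\<Sum>k<b 1. \<Sum>j<b 0. const (\<gamma> j f2) * (M 0 j k * w k))"
    by (simp add: L_def sum_distrib_right mult.assoc)
  also have "\<dots> = (\<Sum>j<b 0. \<Sum>k<b 1. const (\<gamma> j f2) * (M 0 j k * w k))"
    by (rule sum.swap)
  also have "\<dots> = (\<Sum>j<b 0. const (\<gamma> j f2) * v j)"
    using w by (simp add: sum_distrib_left)
  also have "\<dots> = const (\<Sum>j<b 0. \<alpha> f2 j * \<gamma> j f2) * f1 - const (\<Sum>j<b 0. \<alpha> f1 j * \<gamma> j f2) * f2"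
    unfolding const_sum sum_distrib_right sum_subtractf[symmetric]
    by (rule sum.cong) (simp_all add: v_def const_mult algebra_simps)
  also have "\<dots> = f1"
    using F by (simp add: \<delta>)
  finally have "(\<Sum>k<b 1. L k * w k) \<noteq> 0" using \<open>f1 \<noteq> 0\<close> by simp
  then obtain k where "k \<in> {..<b 1}" "L k * w k \<noteq> 0"
    by (rule sum.not_neutral_contains_not_neutral)
  then have k: "k < b 1" "L k \<noteq> 0" by auto
  have "homogeneous 1 (L k)"
    unfolding homogeneous_def
  proof (intro allI impI)
    fix m assume "Poly_Mapping.lookup (L k) m \<noteq> 0"
    then have "(\<Sum>j<b 0. Poly_Mapping.lookup (const (\<gamma> j f2) * M 0 j k) m) \<noteq> 0"
      unfolding L_def lookup_sum .
    then obtain j where "j \<in> {..<b 0}" "Poly_Mapping.lookup (const (\<gamma> j f2) * M 0 j k) m \<noteq> 0"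
      by (rule sum.not_neutral_contains_not_neutral)
    with M_hom[OF _ k(1), of j] show "mdeg m = 1" unfolding homogeneous_def by auto
  qed
  from homogeneous_1_expansion[OF this] k(2)
  have "(\<Sum>x\<in>UNIV. const (Poly_Mapping.lookup (L k) (sng x)) * Var x) \<noteq> 0" by simp
  then obtain x where "const (Poly_Mapping.lookup (L k) (sng x)) * (Var x :: ('x, 'k) mpoly) \<noteq> 0"
    by (rule sum.not_neutral_contains_not_neutral)
  then have x: "Poly_Mapping.lookup (L k) (sng x) \<noteq> 0" by auto
  \<comment> \<open>Column \<open>k\<close> is split by variables: \<open>a x j\<close> is the
    coefficient of \<open>x\<close> in its entry \<open>j\<close>, and \<open>c x\<close> rewrites
    these coefficients in terms of \<open>F\<close>.\<close>
  define a where "a x j = Poly_Mapping.lookup (M 0 j k) (sng x)" for x j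
  define c where "c x f = (\<Sum>j<b 0. a x j * \<gamma> j f)" for x f
  have "c x f2 \<noteq> 0"
    using x unfolding L_def lookup_sum lookup_const_mult c_def a_def by (simp add: mult.commute)
  then have nz: "(\<Sum>f\<in>F. const (c x f) * f) \<noteq> 0"
    using indep[of "c x", OF _ F(2)] by blast
  have "(\<Sum>x\<in>UNIV. Var x * (\<Sum>f\<in>F. const (c x f) * f)) = (\<Sum>x\<in>UNIV. \<Sum>j<b 0. g j * (const (a x j) * Var x))"
    unfolding c_def swap by (simp add: sum_distrib_left mult_ac)
  also have "\<dots> = (\<Sum>j<b 0. \<Sum>x\<in>UNIV. g j * (const (a x j) * Var x))"
    by (rule sum.swap)
  also have "\<dots> = (\<Sum>j<b 0. g j * M 0 j k)"
    unfolding sum_distrib_left[symmetric] a_def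
    using homogeneous_1_expansion[OF M_hom[OF _ k(1)]] by (intro sum.cong) auto
  \<comment> \<open>Column \<open>k\<close> is the image of the \<open>k\<close>-th basis vector,
    hence a syzygy by exactness.\<close>
  also have "\<dots> = 0"
    unfolding exact using k(1)
    by (intro exI[of _ "\<lambda>i. if i = k then 1 else 0"]) (simp add: if_distrib cong: if_cong)
  finally show ?thesis using that nz by blast
qed

section \<open>Monomials congruent modulo a binomial prime ideal\<close>

definition monomial_cong :: "('x, 'k::field) mpoly set \<Rightarrow> 'x monomial \<Rightarrow> 'x monomial \<Rightarrow> bool" where
  "monomial_cong I m n \<longleftrightarrow> (Monom m - Monom n :: ('x, 'k) mpoly) \<in> I"

lemma equivp_monomial_cong:
  assumes I: "ideal I (poly_ring :: ('x, 'k::field) mpoly ring)"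
  shows "equivp (monomial_cong I)"
proof (rule equivpI)
  show "reflp (monomial_cong I)"
    using ideal_zero[OF I] by (auto simp: reflp_def monomial_cong_def)
  show "symp (monomial_cong I)"
    unfolding symp_def monomial_cong_def using ideal_uminus[OF I] by (metis minus_diff_eq)
  show "transp (monomial_cong I)"
    unfolding transp_def monomial_cong_def
  proof (intro allI impI)
    fix a b c
    assume "Monom a - Monom b \<in> I" "Monom b - Monom c \<in> I"
    from ideal_add[OF I this] show "Monom a - Monom c \<in> I" by simp
  qed
qed

text \<open>The simplifier turns \<open>single x 1\<close> into \<open>single x (Suc 0)\<close>.\<close>

lemma sng_add_eq_iff [unfolded One_nat_def]:
  "sng a + sng b = sng c + sng d \<longleftrightarrow> a = c \<and> b = d \<or> a = d \<and> b = c" (is "?l \<longleftrightarrow> ?r")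
proof
  assume ?l
  then have "Poly_Mapping.lookup (sng a + sng b) x = Poly_Mapping.lookup (sng c + sng d) x" for x
    by simp
  from this[of a] this[of b] this[of c] show ?r
    by (auto simp: lookup_add lookup_single when_def split: if_splits)
qed (auto simp: add.commute)

text \<open>Used with \<open>d = 2\<close>: the ideal then contains no nonzero linear form.\<close>

lemma degree_Idl_homogeneous:
  fixes F :: "('x::finite, 'k::field) mpoly set"
  assumes "finite F" "\<And>f. f \<in> F \<Longrightarrow> homogeneous d f" "h \<in> Idl\<^bsub>poly_ring\<^esub> F" "Poly_Mapping.lookup h m \<noteq> 0"
  shows "d \<le> mdeg m"
proof -
  obtain p where "h = (\<Sum>f\<in>F. p f * f)"
    using assms(3) unfolding Idl_finite[OF assms(1)] by auto
  with assms(4) have "(\<Sum>f\<in>F. Poly_Mapping.lookup (p f * f) m) \<noteq> 0" by (simp add: lookup_sum)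
  then obtain f where f: "f \<in> F" "Poly_Mapping.lookup (p f * f) m \<noteq> 0"
    by (rule sum.not_neutral_contains_not_neutral)
  then obtain a b where "m = a + b" "b \<in> Poly_Mapping.keys f"
    using keys_mult[of "p f" f] by (auto simp: in_keys_iff)
  then show ?thesis
    using assms(2)[OF f(1)] by (auto simp: homogeneous_def mdeg_add in_keys_iff)
qed

text \<open>By primality one factor of \<open>x(a - b)\<close> lies in \<open>I\<close>; if
  \<open>a \<noteq> b\<close>, both are nonzero linear forms, which the degree bound
  forbids.\<close>

lemma monomial_cong_cancel:
  fixes I :: "('x::finite, 'k::field) mpoly set"
  assumes "primeideal I poly_ring"
    and deg: "\<And>f m. f \<in> I \<Longrightarrow> Poly_Mapping.lookup f m \<noteq> 0 \<Longrightarrow> 2 \<le> mdeg m"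
    and "monomial_cong I (sng x + sng a) (sng x + sng b)"
  shows "a = b"
proof (rule ccontr)
  assume "a \<noteq> b"
  have "Var x * (Var a - Var b) = (Monom (sng x + sng a) - Monom (sng x + sng b) :: ('x, 'k) mpoly)"
    by (simp add: Var_def Monom_def mult_single right_diff_distrib)
  then have "Var x * (Var a - Var b) \<in> I"
    using assms(3) by (simp add: monomial_cong_def)
  then have "(Var x :: ('x, 'k) mpoly) \<in> I \<or> (Var a - Var b :: ('x, 'k) mpoly) \<in> I"
    using primeideal.I_prime[OF assms(1), of "Var x" "Var a - Var b"] by (simp add: poly_ring_def)
  moreover have "sng b \<noteq> sng a"
    using \<open>a \<noteq> b\<close> sng_add_eq_iff[of b b a a] by auto
  then have "Poly_Mapping.lookup (Var a - Var b :: ('x, 'k) mpoly) (sng a) = 1"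
    by (simp add: Var_def Monom_def lookup_minus lookup_single_not_eq)
  moreover have "Poly_Mapping.lookup (Var x :: ('x, 'k) mpoly) (sng x) = 1"
    by (simp add: Var_def Monom_def)
  ultimately show False
    using deg[of "Var x" "sng x"] deg[of "Var a - Var b" "sng a"] by auto
qed

text \<open>The coefficients 1 and -1 are nonzero in every field, so both monomials survive in the
  support.\<close>

lemma quadratic_binomial_obtains:
  assumes "quadratic_binomial f"
  obtains u v where "u \<noteq> v" "f = Monom u - Monom v" "Poly_Mapping.keys f = {u, v}"
    "mdeg u = 2" "mdeg v = 2"
proof -
  obtain u v where uv: "mdeg u = 2" "mdeg v = 2" "u \<noteq> v" "f = Monom u - Monom v"
    using assms by (auto simp: quadratic_binomial_def)
  then have "Poly_Mapping.keys f = {u, v}"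
    by (auto simp: Monom_def in_keys_iff lookup_minus lookup_single when_def split: if_splits)
  with uv that show ?thesis by blast
qed

section \<open>Walks along a linear syzygy\<close>

lemma finite_card_le_3:
  assumes "finite P" "card P \<le> 3" "a \<in> P" "b \<in> P" "c \<in> P" "a \<noteq> b" "b \<noteq> c" "a \<noteq> c"
  shows "P = {a, b, c}"
proof -
  have "card {a, b, c} = 3" using assms by simp
  then show ?thesis
    using assms by (intro card_seteq[symmetric]) auto
qed

text \<open>A walk alternates between steps inside a congruence class of \<open>S x\<close> and steps
  \<open>(x, m) \<rightarrow> (y, n)\<close> with \<open>x m = y n\<close>. It cannot return to a class after two steps, and as there are
  only three classes, it closes up to a triangle.\<close>

lemma walk_closes:
  fixes S :: "'x::finite \<Rightarrow> 'x monomial set" and P :: "'x monomial set set"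
  assumes "equivp R"
    and cancel: "\<And>x a b. R (sng x + sng a) (sng x + sng b) \<Longrightarrow> a = b"
    and P: "finite P" "card P \<le> 3" "\<And>e. e \<in> P \<Longrightarrow> \<exists>u v. e = {u, v} \<and> R u v"
    and SP: "\<And>x. S x \<subseteq> \<Union>P"
    and deg: "\<And>x m. m \<in> S x \<Longrightarrow> mdeg m = 2"
    and step1: "\<And>x m. m \<in> S x \<Longrightarrow> \<exists>n\<in>S x. n \<noteq> m \<and> R m n"
    and step2: "\<And>x m. m \<in> S x \<Longrightarrow> \<exists>y. \<exists>n\<in>S y. x \<noteq> y \<and> sng x + m = sng y + n"
    and "S w \<noteq> {}"
  obtains x y z p q r where
    "P = {{sng z + sng r, sng y + sng p}, {sng x + sng p, sng z + sng q}, {sng y + sng q, sng x + sng r}}"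
    "sng z + sng r \<noteq> sng y + sng p" "R (sng z + sng r) (sng y + sng p)"
    "sng x + sng p \<noteq> sng z + sng q" "R (sng x + sng p) (sng z + sng q)"
    "sng y + sng q \<noteq> sng x + sng r" "R (sng y + sng q) (sng x + sng r)"
proof -
  have sym: "R b a" if "R a b" for a b using that equivp_symp[OF \<open>equivp R\<close>] by blast
  have trans: "R a c" if "R a b" "R b c" for a b c using that equivp_transp[OF \<open>equivp R\<close>] by blast
  have cancel': "a = b" if "R (sng a + sng x) (sng b + sng x)" for a b x
    using cancel[of x a b] that by (simp add: add.commute)
  have step: "\<exists>m' y n a. m' \<in> S x \<and> m' \<noteq> m \<and> R m m' \<and> n \<in> S y \<and> x \<noteq> y \<and> m' = sng y + sng a \<and> n = sng x + sng a"
    if m: "m \<in> S x" for m x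
  proof -
    obtain m' where m': "m' \<in> S x" "m' \<noteq> m" "R m m'" using step1[OF m] by auto
    obtain y n where n: "n \<in> S y" "x \<noteq> y" "sng x + m' = sng y + n" using step2[OF m'(1)] by auto
    from n(3,2) deg[OF m'(1)] obtain a where "m' = sng y + sng a" "n = sng x + sng a"
      by (rule exchange)
    with m' n show ?thesis by blast
  qed
  \<comment> \<open>Otherwise \<open>ya\<close> and \<open>xa\<close> would be congruent, and
    cancelling \<open>a\<close> would give \<open>x = y\<close>.\<close>
  have next_class: "\<not> R m n"
    if "R m m'" "x \<noteq> y" "m' = sng y + sng a" "n = sng x + sng a" for m m' n x y a
    using that cancel'[of y a x] trans[OF sym, of m m' n] by auto
  \<comment> \<open>Otherwise \<open>ya\<close> and \<open>yb\<close> are congruent, so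
    \<open>a = b\<close>; then \<open>xa\<close> and \<open>za\<close> are congruent, so
    \<open>x = z\<close> and \<open>n = n'\<close>.\<close>
  have no_return: "\<not> R m k"
    if "R m m'" "m' = sng y + sng a" "n = sng x + sng a" "R n n'" "n \<noteq> n'" "n' = sng z + sng b" "k = sng y + sng b"
    for m m' n n' k x y z a b
  proof
    assume "R m k"
    with that have "R (sng y + sng a) (sng y + sng b)" using trans sym by metis
    with that show False using cancel cancel' by metis
  qed
  \<comment> \<open>Four steps are taken: \<open>m1\<close>, \<open>m2\<close>, \<open>m3\<close>
    exhaust the classes, and the fourth step serves to show \<open>t = x\<close>.\<close>
  obtain x m1 where 1: "m1 \<in> S x" using \<open>S w \<noteq> {}\<close> by auto
  obtain m1' y m2 p where 12: "m1' \<in> S x" "m1' \<noteq> m1" "R m1 m1'" "m2 \<in> S y" "x \<noteq> y"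
      "m1' = sng y + sng p" "m2 = sng x + sng p"
    using step[OF 1] by auto
  obtain m2' z m3 q where 23: "m2' \<in> S y" "m2' \<noteq> m2" "R m2 m2'" "m3 \<in> S z" "y \<noteq> z"
      "m2' = sng z + sng q" "m3 = sng y + sng q"
    using step[OF 12(4)] by auto
  obtain m3' t m4 r where 34: "m3' \<in> S z" "m3' \<noteq> m3" "R m3 m3'" "m4 \<in> S t" "z \<noteq> t"
      "m3' = sng t + sng r" "m4 = sng z + sng r"
    using step[OF 23(4)] by auto
  obtain m4' s m5 l where 45: "m4' \<in> S t" "m4' \<noteq> m4" "R m4 m4'" "m5 \<in> S s" "t \<noteq> s"
      "m4' = sng s + sng l" "m5 = sng t + sng l"
    using step[OF 34(4)] by auto
  have n12: "\<not> R m1 m2" by (rule next_class[OF 12(3,5-7)])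
  have n23: "\<not> R m2 m3" by (rule next_class[OF 23(3,5-7)])
  have n34: "\<not> R m3 m4" by (rule next_class[OF 34(3,5-7)])
  have n45: "\<not> R m4 m5" by (rule next_class[OF 45(3,5-7)])
  have n13: "\<not> R m1 m3" by (rule no_return[OF 12(3,6,7) 23(3) 23(2)[symmetric] 23(6,7)])
  have n24: "\<not> R m2 m4" by (rule no_return[OF 23(3,6,7) 34(3) 34(2)[symmetric] 34(6,7)])
  have n35: "\<not> R m3 m5" by (rule no_return[OF 34(3,6,7) 45(3) 45(2)[symmetric] 45(6,7)])
  have in_class: "R a b" if ab: "e \<in> P" "a \<in> e" "b \<in> e" for e a b
  proof -
    obtain u v where "e = {u, v}" "R u v" using P(3)[OF ab(1)] by auto
    with ab show ?thesis using sym trans by blast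
  qed
  obtain e1 e2 e3 where e: "e1 \<in> P" "m1 \<in> e1" "e2 \<in> P" "m2 \<in> e2" "e3 \<in> P" "m3 \<in> e3"
    using SP 1 12(4) 23(4) by (meson Union_iff subsetD)
  have "e1 \<noteq> e2" "e2 \<noteq> e3" "e1 \<noteq> e3"
    using e n12 n23 n13 in_class by blast+
  then have Pe: "P = {e1, e2, e3}"
    using e by (intro finite_card_le_3 P)
  have S_cases: "m \<in> e1 \<or> m \<in> e2 \<or> m \<in> e3" if "m \<in> S v" for m v
    using SP[of v] that by (auto simp: Pe)
  \<comment> \<open>Each primed monomial is congruent to its partner, so it lies in the same one of
    the three pairs.\<close>
  have "m1' \<notin> e2" "m1' \<notin> e3" "m2' \<notin> e1" "m2' \<notin> e3" "m3' \<notin> e1" "m3' \<notin> e2"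
    using in_class[OF e(3) _ e(4), of m1'] in_class[OF e(5) _ e(6), of m1']
      in_class[OF e(1,2), of m2'] in_class[OF e(5) _ e(6), of m2']
      in_class[OF e(1,2), of m3'] in_class[OF e(3,4), of m3']
      trans[OF 12(3), of m2] trans[OF 12(3), of m3] trans[OF 23(3), of m3]
      trans[OF _ sym[OF 23(3)], of m1] trans[OF _ sym[OF 34(3)], of m1] trans[OF _ sym[OF 34(3)], of m2]
      n12 n23 n13 by auto
  then have "m1' \<in> e1" "m2' \<in> e2" "m3' \<in> e3"
    using S_cases[OF 12(1)] S_cases[OF 23(1)] S_cases[OF 34(1)] by auto
  moreover have "\<exists>u v. e1 = {u, v}" "\<exists>u v. e2 = {u, v}" "\<exists>u v. e3 = {u, v}"
    using P(3)[OF e(1)] P(3)[OF e(3)] P(3)[OF e(5)] by auto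
  ultimately have e1: "e1 = {m1, m1'}" and e2: "e2 = {m2, m2'}" and e3: "e3 = {m3, m3'}"
    using e(2,4,6) 12(2) 23(2) 34(2) by auto
  \<comment> \<open>Neither the class just left nor the one before it is possible.\<close>
  have "m4 \<in> e1"
    using S_cases[OF 34(4)] in_class[OF e(3,4), of m4] in_class[OF e(5,6), of m4] n24 n34 by auto
  \<comment> \<open>From \<open>zr = yp\<close> and \<open>y \<noteq> z\<close> follows
    \<open>z = p\<close>; cancelling \<open>z\<close> in the second class gives \<open>x = q\<close>
    and the contradiction \<open>m2 = m2'\<close>.\<close>
  have "m4 \<noteq> m1'"
  proof
    assume "m4 = m1'"
    with 34(7) 12(6) 23(5) have "z = p" by (auto simp: sng_add_eq_iff)
    with 12(7) 23(6,3) have "R (sng z + sng x) (sng z + sng q)" by (simp add: add.commute)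
    then have "x = q" by (rule cancel)
    with \<open>z = p\<close> 12(7) 23(2,6) show False by (simp add: add.commute)
  qed
  with \<open>m4 \<in> e1\<close> have m4: "m4 = m1" by (simp add: e1)
  then have "m4' \<in> e1"
    using S_cases[OF 45(1)] in_class[OF e(3) _ e(4), of m4'] in_class[OF e(5) _ e(6), of m4']
      trans[OF 45(3), of m2] trans[OF 45(3), of m3] n12 n13 by auto
  with m4 45(2) have m4': "m4' = m1'" by (simp add: e1)
  have "m5 \<in> e2"
    using S_cases[OF 45(4)] in_class[OF e(1,2), of m5] in_class[OF e(5,6), of m5] n35 n45 m4 by auto
  \<comment> \<open>Here \<open>m5 = tl\<close> is \<open>xp\<close> or \<open>zq\<close>. In the
    first case \<open>t = p\<close> and \<open>l = x\<close>, and \<open>sl = yp\<close> forces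
    \<open>t = x\<close>; in the second \<open>t = q\<close>, and cancelling \<open>q\<close> in the
    third class makes \<open>m3 = m3'\<close>.\<close>
  have "t = x"
  proof (rule ccontr)
    assume "t \<noteq> x"
    have l: "sng s + sng l = sng y + sng p" using m4' 45(6) 12(6) by simp
    consider "m5 = m2" | "m5 = m2'" using \<open>m5 \<in> e2\<close> by (auto simp: e2)
    then show False
    proof cases
      case 1
      with 45(7) 12(7) \<open>t \<noteq> x\<close> have "t = p" "l = x" by (auto simp: sng_add_eq_iff)
      with l 12(5) \<open>t \<noteq> x\<close> show False by (auto simp: sng_add_eq_iff)
    next
      case 2
      with 45(7) 23(6) 34(5) have "t = q" by (auto simp: sng_add_eq_iff)
      with 34(3,6) 23(7) have "R (sng q + sng y) (sng q + sng r)" by (simp add: add.commute)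
      then have "y = r" by (rule cancel)
      with \<open>t = q\<close> 34(2,6) 23(7) show False by (simp add: add.commute)
    qed
  qed
  then show ?thesis
    using that[of z r y p x q] Pe e1 e2 e3 m4 12 23 34 sym by auto
qed

section \<open>The triangle of generators\<close>

text \<open>The two coefficients of a binomial in \<open>F\<close> cancel within a congruence class,
  so the coefficients of \<open>h\<close> over each class sum to zero. A class thus cannot meet the
  support of \<open>h\<close> in just one monomial.\<close>

lemma binomial_combination_class:
  fixes F I :: "('x::finite, 'k::field) mpoly set"
  assumes I: "ideal I poly_ring" and "finite F" "F \<subseteq> I" and qb: "\<And>f. f \<in> F \<Longrightarrow> quadratic_binomial f"
    and h: "h = (\<Sum>f\<in>F. const (c f) * f)" and m: "Poly_Mapping.lookup h m \<noteq> 0"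
  shows "\<exists>n. Poly_Mapping.lookup h n \<noteq> 0 \<and> n \<noteq> m \<and> monomial_cong I m n"
proof (rule ccontr)
  assume "\<not> ?thesis"
  then have zero: "Poly_Mapping.lookup h n = 0" if "n \<noteq> m" "monomial_cong I m n" for n
    using that by blast
  note eq = equivp_monomial_cong[OF I]
  define T where "T = {n \<in> \<Union>(Poly_Mapping.keys ` F). monomial_cong I m n}"
  have "finite T" using \<open>finite F\<close> by (simp add: T_def)
  have "(\<Sum>n\<in>T. Poly_Mapping.lookup f n) = 0" if f: "f \<in> F" for f
  proof -
    obtain u v where uv: "u \<noteq> v" "f = Monom u - Monom v" "Poly_Mapping.keys f = {u, v}"
        "mdeg u = 2" "mdeg v = 2"
      by (rule quadratic_binomial_obtains[OF qb[OF f]])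
    then have "monomial_cong I u v" using f \<open>F \<subseteq> I\<close> by (auto simp: monomial_cong_def)
    then have "monomial_cong I m u \<longleftrightarrow> monomial_cong I m v"
      using equivp_symp[OF eq] equivp_transp[OF eq] by blast
    then have "u \<in> T \<longleftrightarrow> v \<in> T"
      using f uv(3) by (auto simp: T_def)
    then show ?thesis
      using \<open>finite T\<close> by (simp add: uv(2) Monom_def lookup_minus lookup_single when_def sum_subtractf)
  qed
  then have "(\<Sum>f\<in>F. c f * (\<Sum>n\<in>T. Poly_Mapping.lookup f n)) = 0" by simp
  then have "(\<Sum>n\<in>T. Poly_Mapping.lookup h n) = 0"
    unfolding h lookup_sum by (subst sum.swap) (simp add: sum_distrib_left)
  moreover have "m \<in> T"
  proof -
    from m have "(\<Sum>f\<in>F. Poly_Mapping.lookup (const (c f) * f) m) \<noteq> 0" by (simp add: h lookup_sum)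
    then obtain f where "f \<in> F" "Poly_Mapping.lookup (const (c f) * f) m \<noteq> 0"
      by (rule sum.not_neutral_contains_not_neutral)
    then show ?thesis using equivp_reflp[OF eq] by (auto simp: T_def in_keys_iff)
  qed
  then have "(\<Sum>n\<in>T. Poly_Mapping.lookup h n) = Poly_Mapping.lookup h m"
    using \<open>finite T\<close> zero by (subst sum.remove[of T m]) (auto simp: T_def intro!: sum.neutral)
  ultimately show False using m by simp
qed

text \<open>The coefficient of \<open>x m\<close> in the vanishing sum is zero, so the contribution
  of \<open>Var x * h x\<close> must be cancelled by another summand.\<close>

lemma linear_syzygy_step:
  fixes h :: "'x::finite \<Rightarrow> ('x, 'k::field) mpoly"
  assumes "(\<Sum>x\<in>UNIV. Var x * h x) = 0" and m: "Poly_Mapping.lookup (h x) m \<noteq> 0"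
  shows "\<exists>y n. Poly_Mapping.lookup (h y) n \<noteq> 0 \<and> x \<noteq> y \<and> sng x + m = sng y + n"
proof -
  let ?l = "\<lambda>y. Poly_Mapping.lookup (Var y * h y) (sng x + m)"
  have "(\<Sum>y\<in>UNIV. ?l y) = 0"
    using assms(1) by (simp add: lookup_sum[symmetric])
  moreover have "(\<Sum>y\<in>UNIV. ?l y) = ?l x + (\<Sum>y\<in>UNIV - {x}. ?l y)"
    by (rule sum.remove) auto
  moreover have "?l x \<noteq> 0" using m unfolding Var_def lookup_Monom_mult .
  ultimately have "(\<Sum>y\<in>UNIV - {x}. ?l y) \<noteq> 0" by auto
  then obtain y where y: "y \<in> UNIV - {x}" "?l y \<noteq> 0"
    by (rule sum.not_neutral_contains_not_neutral)
  from y(2) obtain n where "sng x + m = sng y + n" "Poly_Mapping.lookup (h y) n \<noteq> 0"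
    unfolding Var_def by (rule keys_Monom_mult)
  with y(1) show ?thesis by blast
qed

text \<open>A quadratic binomial is determined up to sign by its support.\<close>

lemma binomials_in_Idl:
  assumes "\<And>f. f \<in> F \<Longrightarrow> quadratic_binomial f" "\<And>g. g \<in> G \<Longrightarrow> quadratic_binomial g"
    and "Poly_Mapping.keys ` F \<subseteq> Poly_Mapping.keys ` G"
  shows "F \<subseteq> Idl\<^bsub>poly_ring\<^esub> G"
proof
  fix f assume f: "f \<in> F"
  with assms(3) obtain g where g: "g \<in> G" "Poly_Mapping.keys f = Poly_Mapping.keys g" by blast
  obtain u v where uv: "u \<noteq> v" "f = Monom u - Monom v" "Poly_Mapping.keys f = {u, v}"
      "mdeg u = 2" "mdeg v = 2"
    by (rule quadratic_binomial_obtains[OF assms(1)[OF f]])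
  obtain u' v' where uv': "u' \<noteq> v'" "g = Monom u' - Monom v'" "Poly_Mapping.keys g = {u', v'}"
      "mdeg u' = 2" "mdeg v' = 2"
    by (rule quadratic_binomial_obtains[OF assms(2)[OF g(1)]])
  have "u = u' \<and> v = v' \<or> u = v' \<and> v = u'"
    using g(2) uv(3) uv'(3) by (auto simp: doubleton_eq_iff)
  then have "f = g \<or> f = - g" using uv(2) uv'(2) by auto
  moreover have "g \<in> Idl\<^bsub>poly_ring\<^esub> G" using subset_Idl[of G] g(1) by auto
  ultimately show "f \<in> Idl\<^bsub>poly_ring\<^esub> G" using ideal_uminus[OF ideal_Idl] by blast
qed

lemma Var_binomial:
  fixes a b c d :: "'x::finite"
  assumes "sng a + sng b \<noteq> sng c + sng d"
  defines "f \<equiv> (Var a * Var b - Var c * Var d :: ('x, 'k::field) mpoly)"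
  shows "quadratic_binomial f" "Poly_Mapping.keys f = {sng a + sng b, sng c + sng d}"
proof -
  have f: "f = Monom (sng a + sng b) - Monom (sng c + sng d)"
    by (simp add: f_def Var_def Monom_def mult_single)
  with assms(1) show "quadratic_binomial f"
    unfolding quadratic_binomial_def by (intro exI conjI) (auto simp: mdeg_add)
  from f assms(1) show "Poly_Mapping.keys f = {sng a + sng b, sng c + sng d}"
    by (auto simp: Monom_def in_keys_iff lookup_minus lookup_single when_def split: if_splits)
qed

lemma triangle_of_generators:
  fixes F I :: "('x::finite, 'k::field) mpoly set"
  assumes card: "card F = 3" and qb: "\<And>f. f \<in> F \<Longrightarrow> quadratic_binomial f"
    and min: "minimally_generates poly_ring F I"
    and prime: "primeideal I poly_ring"
    and res: "has_linear_resolution 2 I"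
  obtains x y z p q r where
    "Poly_Mapping.keys ` F =
      {{sng x + sng r, sng y + sng q}, {sng x + sng p, sng z + sng q}, {sng y + sng p, sng z + sng r}}"
    "distinct [x, y, z]" "distinct [p, q, r]" "x \<noteq> q" "y \<noteq> r" "z \<noteq> p"
    "I = Idl\<^bsub>poly_ring\<^esub>
      {Var x * Var r - Var y * Var q, Var x * Var p - Var z * Var q, Var y * Var p - Var z * Var r}"
proof -
  have fin: "finite F" using card by (intro card_ge_0_finite) simp
  have I: "I = Idl\<^bsub>poly_ring\<^esub> F" using min by (simp add: minimally_generates_def)
  have ideal: "ideal I poly_ring" unfolding I by (rule ideal_Idl)
  have FI: "F \<subseteq> I" unfolding I by (rule subset_Idl)
  have hom: "homogeneous 2 f" if f: "f \<in> F" for f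
  proof -
    obtain u v where "u \<noteq> v" "f = Monom u - Monom v" "Poly_Mapping.keys f = {u, v}"
        "mdeg u = 2" "mdeg v = 2"
      by (rule quadratic_binomial_obtains[OF qb[OF f]])
    then show ?thesis unfolding homogeneous_def in_keys_iff[symmetric] by auto
  qed
  have deg_I: "2 \<le> mdeg m" if "f \<in> I" "Poly_Mapping.lookup f m \<noteq> 0" for f m
    using degree_Idl_homogeneous[of F 2 f m] fin hom that I by simp
  have cancel: "a = b" if "monomial_cong I (sng x + sng a) (sng x + sng b)" for x a b
    using monomial_cong_cancel[OF prime _ that] deg_I by simp
  \<comment> \<open>A common variable could be cancelled, which would make the two monomials
    equal.\<close>
  have coprime: "a \<noteq> c \<and> a \<noteq> d \<and> b \<noteq> c \<and> b \<noteq> d"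
    if "monomial_cong I (sng a + sng b) (sng c + sng d)" "sng a + sng b \<noteq> sng c + sng d" for a b c d
    using that cancel[of a b d] cancel[of a b c] cancel[of b a d] cancel[of b a c]
    by (auto simp: add.commute)
  have card_ge: "2 \<le> card F" using card by simp
  obtain c w where syz: "(\<Sum>x\<in>UNIV. Var x * (\<Sum>f\<in>F. const (c x f) * f)) = 0"
    and nz: "(\<Sum>f\<in>F. const (c w f) * f) \<noteq> 0"
    by (rule linear_syzygy_obtains[OF res fin card_ge min hom])
  define h where "h x = (\<Sum>f\<in>F. const (c x f) * f)" for x
  define S where "S x = {m. Poly_Mapping.lookup (h x) m \<noteq> 0}" for x
  have S_keys: "\<exists>f\<in>F. m \<in> Poly_Mapping.keys f" if "m \<in> S x" for m x
  proof -
    from that have "(\<Sum>f\<in>F. Poly_Mapping.lookup (const (c x f) * f) m) \<noteq> 0"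
      by (simp add: S_def h_def lookup_sum)
    then obtain f where "f \<in> F" "Poly_Mapping.lookup (const (c x f) * f) m \<noteq> 0"
      by (rule sum.not_neutral_contains_not_neutral)
    then show ?thesis by (auto simp: in_keys_iff)
  qed
  have "S w \<noteq> {}"
  proof
    assume "S w = {}"
    then have "h w = 0" by (intro poly_mapping_eqI) (auto simp: S_def)
    with nz show False by (simp add: h_def)
  qed
  \<comment> \<open>The walk runs through the supports \<open>S x\<close> of the \<open>h x\<close>,
    and its classes are the supports of the generators.\<close>
  obtain x y z p q r where keys:
      "Poly_Mapping.keys ` F =
        {{sng z + sng r, sng y + sng p}, {sng x + sng p, sng z + sng q}, {sng y + sng q, sng x + sng r}}"
    and 1: "sng z + sng r \<noteq> sng y + sng p" "monomial_cong I (sng z + sng r) (sng y + sng p)"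
    and 2: "sng x + sng p \<noteq> sng z + sng q" "monomial_cong I (sng x + sng p) (sng z + sng q)"
    and 3: "sng y + sng q \<noteq> sng x + sng r" "monomial_cong I (sng y + sng q) (sng x + sng r)"
  proof (rule walk_closes[where S = S and w = w and R = "monomial_cong I" and P = "Poly_Mapping.keys ` F"])
    show "equivp (monomial_cong I)" by (rule equivp_monomial_cong[OF ideal])
    show "a = b" if "monomial_cong I (sng x + sng a) (sng x + sng b)" for x a b
      using that by (rule cancel)
    show "finite (Poly_Mapping.keys ` F)" "card (Poly_Mapping.keys ` F) \<le> 3"
      using fin card card_image_le[OF fin] by auto
    show "\<exists>u v. e = {u, v} \<and> monomial_cong I u v" if e: "e \<in> Poly_Mapping.keys ` F" for e
    proof -
      from e obtain f where f: "f \<in> F" "e = Poly_Mapping.keys f" by auto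
      obtain u v where "u \<noteq> v" "f = Monom u - Monom v" "Poly_Mapping.keys f = {u, v}"
          "mdeg u = 2" "mdeg v = 2"
        by (rule quadratic_binomial_obtains[OF qb[OF f(1)]])
      with f FI show ?thesis by (auto simp: monomial_cong_def)
    qed
    show "S x \<subseteq> \<Union>(Poly_Mapping.keys ` F)" for x using S_keys by blast
    show "mdeg m = 2" if "m \<in> S x" for x m
      using S_keys[OF that] hom by (auto simp: homogeneous_def in_keys_iff)
    show "\<exists>n\<in>S x. n \<noteq> m \<and> monomial_cong I m n" if "m \<in> S x" for x m
      using binomial_combination_class[OF ideal fin FI qb h_def[of x], of m] that by (auto simp: S_def)
    show "\<exists>y. \<exists>n\<in>S y. x \<noteq> y \<and> sng x + m = sng y + n" if "m \<in> S x" for x m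
      using linear_syzygy_step[OF syz[folded h_def], of x m] that by (auto simp: S_def)
  qed (use \<open>S w \<noteq> {}\<close> in auto)
  define G :: "('x, 'k) mpoly set" where
    "G = {Var x * Var r - Var y * Var q, Var x * Var p - Var z * Var q, Var y * Var p - Var z * Var r}"
  have "quadratic_binomial g" if "g \<in> G" for g
    using that Var_binomial(1)[OF 3(1)[symmetric], where 'k = 'k] Var_binomial(1)[OF 2(1), where 'k = 'k]
      Var_binomial(1)[OF 1(1)[symmetric], where 'k = 'k]
    by (auto simp: G_def mult.commute)
  moreover have keys': "Poly_Mapping.keys ` F =
      {{sng x + sng r, sng y + sng q}, {sng x + sng p, sng z + sng q}, {sng y + sng p, sng z + sng r}}"
    unfolding keys by auto
  moreover have "Poly_Mapping.keys ` G = Poly_Mapping.keys ` F"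
    unfolding keys' G_def
    using Var_binomial(2)[OF 3(1)[symmetric], where 'k = 'k] Var_binomial(2)[OF 2(1), where 'k = 'k]
      Var_binomial(2)[OF 1(1)[symmetric], where 'k = 'k]
    by simp
  ultimately have "I = Idl\<^bsub>poly_ring\<^esub> G"
    unfolding I using qb by (intro Idl_eqI binomials_in_Idl) auto
  with that[OF keys'] show ?thesis
    using coprime[OF 1(2,1)] coprime[OF 2(2,1)] coprime[OF 3(2,1)] by (auto simp: G_def)
qed

lemma squarefree_quadratic_binomialD:
  assumes "squarefree_quadratic_binomial f"
  shows "quadratic_binomial f" "sng a + sng b \<in> Poly_Mapping.keys f \<Longrightarrow> a \<noteq> b"
proof -
  obtain u v where uv: "mdeg u = 2" "mdeg v = 2" "u \<noteq> v" "f = Monom u - Monom v"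
    "squarefree_monomial u" "squarefree_monomial v"
    using assms by (auto simp: squarefree_quadratic_binomial_def)
  then show "quadratic_binomial f" by (auto simp: quadratic_binomial_def)
  assume "sng a + sng b \<in> Poly_Mapping.keys f"
  then have "squarefree_monomial (sng a + sng b)"
    using uv by (auto simp: Monom_def in_keys_iff lookup_minus lookup_single when_def split: if_splits)
  then have "Poly_Mapping.lookup (sng a + sng b) a \<le> 1" unfolding squarefree_monomial_def by blast
  then show "a \<noteq> b" by (auto simp: lookup_add)
qed

lemma two_minors_2_3:
  "two_minors 2 3 A =
    {A 0 0 * A 1 1 - A 0 1 * A 1 0, A 0 0 * A 1 2 - A 0 2 * A 1 0, A 0 1 * A 1 2 - A 0 2 * A 1 1}"
proof -
  have "i < k \<and> k < 2 \<and> j < l \<and> l < 3 \<longleftrightarrow>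
    i = 0 \<and> k = 1 \<and> (j = 0 \<and> l = 1 \<or> j = 0 \<and> l = 2 \<or> j = 1 \<and> l = 2)" for i j k l :: nat
    by auto
  then show ?thesis unfolding two_minors_def by auto
qed

theorem theorem1p1:
  fixes I :: "('x::finite, 'k::field) mpoly set"
  assumes "\<exists>F. card F = 3 \<and> (\<forall>f\<in>F. quadratic_binomial f) \<and> minimally_generates poly_ring F I"
    and "primeideal I poly_ring"
    and "cohen_macaulay (poly_ring Quot I)"
    and "has_linear_resolution 2 I"
  shows "(\<exists>r c (A :: nat \<Rightarrow> nat \<Rightarrow> 'x). I = Idl\<^bsub>poly_ring\<^esub> (two_minors r c (\<lambda>i j. Var (A i j))))
    \<and> ((\<exists>F. card F = 3 \<and> (\<forall>f\<in>F. squarefree_quadratic_binomial f) \<and>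
            minimally_generates poly_ring F I) \<longrightarrow>
        (\<exists>x1 x2 x3 y1 y2 y3 :: 'x. distinct [x1, x2, x3, y1, y2, y3] \<and>
           I = Idl\<^bsub>poly_ring\<^esub>
             {Var x1 * Var y2 - Var x2 * Var y1,
              Var x1 * Var y3 - Var x3 * Var y1,
              Var x2 * Var y3 - Var x3 * Var y2}))"
proof (intro conjI impI)
  obtain F where F: "card F = 3" "\<And>f. f \<in> F \<Longrightarrow> quadratic_binomial f" "minimally_generates poly_ring F I"
    using assms(1) by blast
  obtain x y z p q r where "I = Idl\<^bsub>poly_ring\<^esub>
      {Var x * Var r - Var y * Var q, Var x * Var p - Var z * Var q, Var y * Var p - Var z * Var r}"
    by (rule triangle_of_generators[OF F assms(2,4)])
  \<comment> \<open>The minors read only row indices below 2 and column indices below 3, so list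
    access stays in range.\<close>
  also have "\<dots> = Idl\<^bsub>poly_ring\<^esub> (two_minors 2 3 (\<lambda>i j. Var ([[x, y, z], [q, r, p]] ! i ! j)))"
    by (simp add: two_minors_2_3)
  finally show "\<exists>r c (A :: nat \<Rightarrow> nat \<Rightarrow> 'x). I = Idl\<^bsub>poly_ring\<^esub> (two_minors r c (\<lambda>i j. Var (A i j)))"
    by (intro exI[of _ 2] exI[of _ 3] exI[of _ "\<lambda>i j. [[x, y, z], [q, r, p]] ! i ! j"])
next
  assume "\<exists>F. card F = 3 \<and> (\<forall>f\<in>F. squarefree_quadratic_binomial f) \<and> minimally_generates poly_ring F I"
  then obtain F where F: "card F = 3" "minimally_generates poly_ring F I"
    and sqf: "\<And>f. f \<in> F \<Longrightarrow> squarefree_quadratic_binomial f"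
    by blast
  obtain x y z p q r where keys: "Poly_Mapping.keys ` F =
      {{sng x + sng r, sng y + sng q}, {sng x + sng p, sng z + sng q}, {sng y + sng p, sng z + sng r}}"
    and ne: "distinct [x, y, z]" "distinct [p, q, r]" "x \<noteq> q" "y \<noteq> r" "z \<noteq> p"
    and I: "I = Idl\<^bsub>poly_ring\<^esub>
      {Var x * Var r - Var y * Var q, Var x * Var p - Var z * Var q, Var y * Var p - Var z * Var r}"
    by (rule triangle_of_generators[OF F(1) squarefree_quadratic_binomialD(1)[OF sqf] F(2) assms(2,4)])
  have "a \<noteq> b" if ab: "sng a + sng b \<in> \<Union>(Poly_Mapping.keys ` F)" for a b
  proof -
    from ab obtain f where "f \<in> F" "sng a + sng b \<in> Poly_Mapping.keys f" by auto
    then show ?thesis using squarefree_quadratic_binomialD(2)[OF sqf] by blast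
  qed
  \<comment> \<open>Coprimality settles nine of the fifteen pairs of variables; squarefreeness of
    the six monomials settles the others.\<close>
  from this[of x r] this[of y q] this[of x p] this[of z q] this[of y p] this[of z r]
  have "distinct [x, y, z, q, r, p]"
    using ne unfolding keys by auto
  \<comment> \<open>The variables \<open>q\<close>, \<open>r\<close>, \<open>p\<close> become
    \<open>y1\<close>, \<open>y2\<close>, \<open>y3\<close>, in this order.\<close>
  with I show "\<exists>x1 x2 x3 y1 y2 y3 :: 'x. distinct [x1, x2, x3, y1, y2, y3] \<and>
      I = Idl\<^bsub>poly_ring\<^esub>
        {Var x1 * Var y2 - Var x2 * Var y1,
         Var x1 * Var y3 - Var x3 * Var y1,
         Var x2 * Var y3 - Var x3 * Var y2}"
    by blast
qed

end
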